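(* Let $X$ be a space. (i) If $X$ is discrete, then $\mathcal F[X]$ is discrete. In particular, both $X$ and $\mathcal F[X]$ are discretely selective. (ii) If $X$ is $T_1$, injectively discretely selective, and nowhere separable, then $\mathcal F[X]$ is discretely selective (by virtue of being injectively discretely selective).
   Context: $\mathbb N$ is the set of positive integers. A space is a nonempty topological space. A subset $A$ of a space $X$ is closed and relatively discrete if $A$ is closed and for every $x\in A$ there is an open $U\subseteq X$ with $U\cap A=\{x\}$. $X$ is discretely selective if for every sequence $\langle U_n:n\in\mathbb N\rangle$ of nonempty open subsets of $X$ there are $x_n\in U_n$ ($n\in\mathbb N$) such that $\{x_n:n\in\mathbb N\}$ is closed and relatively discrete in $X$. $X$ is injectively discretely selective if for every such sequence the points $x_n\in U_n$ can be chosen so that, in addition, $n\mapsto x_n$ is injective. $X$ is nowhere separable if no nonempty open subset of $X$ is separable (as a subspace). $\mathcal F[X]$ is the set $[X]^{<\aleph_0}$ of nonempty finite subsets of $X$ with the Pixley-Roy topology, which has as a basis the sets $[F,U]=\{G\in[X]^{<\aleph_0}:F\subseteq G\subseteq U\}$, where $F\in[X]^{<\aleph_0}$ and $U$ is a nonempty open subset of $X$. *)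

theory Defs
  imports "HOL-Analysis.Analysis"
begin

definition closed_relatively_discrete :: "'a topology \<Rightarrow> 'a set \<Rightarrow> bool" where
  "closed_relatively_discrete X A \<longleftrightarrow>
     closedin X A \<and> (\<forall>x\<in>A. \<exists>U. openin X U \<and> U \<inter> A = {x})"

text \<open>Sequences indexed by the positive integers are rendered as functions on \<open>nat\<close>,
  the index \<open>n\<close> standing for the positive integer \<open>n + 1\<close>.\<close>

definition discretely_selective :: "'a topology \<Rightarrow> bool" where
  "discretely_selective X \<longleftrightarrow>
     (\<forall>U :: nat \<Rightarrow> 'a set. (\<forall>n. openin X (U n) \<and> U n \<noteq> {}) \<longrightarrow>
        (\<exists>x :: nat \<Rightarrow> 'a. (\<forall>n. x n \<in> U n) \<and> closed_relatively_discrete X (range x)))"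

definition injectively_discretely_selective :: "'a topology \<Rightarrow> bool" where
  "injectively_discretely_selective X \<longleftrightarrow>
     (\<forall>U :: nat \<Rightarrow> 'a set. (\<forall>n. openin X (U n) \<and> U n \<noteq> {}) \<longrightarrow>
        (\<exists>x :: nat \<Rightarrow> 'a. (\<forall>n. x n \<in> U n) \<and> closed_relatively_discrete X (range x) \<and> inj x))"

definition nowhere_separable :: "'a topology \<Rightarrow> bool" where
  "nowhere_separable X \<longleftrightarrow>
     (\<forall>U. openin X U \<and> U \<noteq> {} \<longrightarrow> \<not> separable_space (subtopology X U))"

definition discrete_space :: "'a topology \<Rightarrow> bool" where
  "discrete_space X \<longleftrightarrow> X = discrete_topology (topspace X)"

definition finite_subsets :: "'a topology \<Rightarrow> 'a set set" where
  "finite_subsets X = {F. finite F \<and> F \<noteq> {} \<and> F \<subseteq> topspace X}"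

definition pixley_roy_box :: "'a topology \<Rightarrow> 'a set \<Rightarrow> 'a set \<Rightarrow> 'a set set" where
  "pixley_roy_box X F U = {G \<in> finite_subsets X. F \<subseteq> G \<and> G \<subseteq> U}"

definition pixley_roy_base :: "'a topology \<Rightarrow> 'a set set set" where
  "pixley_roy_base X =
     {pixley_roy_box X F U | F U. F \<in> finite_subsets X \<and> openin X U \<and> U \<noteq> {}}"

definition pixley_roy :: "'a topology \<Rightarrow> 'a set topology" where
  "pixley_roy X = topology (arbitrary union_of (\<lambda>B. B \<in> pixley_roy_base X))"

text \<open>The function \<open>topology\<close> is unspecified on families that are not topologies, so it has to be
  checked that the unions of boxes form one.\<close>

lemma openin_pixley_roy:
  "openin (pixley_roy X) = arbitrary union_of (\<lambda>B. B \<in> pixley_roy_base X)"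
proof -
  have "(arbitrary union_of (\<lambda>B. B \<in> pixley_roy_base X)) (S \<inter> T)"
    if ST: "S \<in> pixley_roy_base X" "T \<in> pixley_roy_base X" for S T
  proof -
    obtain F U where S: "S = pixley_roy_box X F U" "F \<in> finite_subsets X" "openin X U"
      using ST(1) by (auto simp: pixley_roy_base_def)
    obtain G V where T: "T = pixley_roy_box X G V" "G \<in> finite_subsets X" "openin X V"
      using ST(2) by (auto simp: pixley_roy_base_def)
    have eq: "S \<inter> T = pixley_roy_box X (F \<union> G) (U \<inter> V)"
      by (auto simp: S T pixley_roy_box_def)
    have FG: "F \<union> G \<in> finite_subsets X" and UV: "openin X (U \<inter> V)"
      using S T by (auto simp: finite_subsets_def)
    show ?thesis
    proof (cases "U \<inter> V = {}")
      case True
      then have "S \<inter> T = {}"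
        by (auto simp: eq pixley_roy_box_def finite_subsets_def)
      then show ?thesis by simp
    next
      case False
      then have "S \<inter> T \<in> pixley_roy_base X"
        unfolding eq pixley_roy_base_def using FG UV by blast
      then show ?thesis by (simp add: union_of_inc arbitrary_def)
    qed
  qed
  then have "istopology (arbitrary union_of (\<lambda>B. B \<in> pixley_roy_base X))"
    by (simp add: istopology_base_eq)
  then show ?thesis
    by (simp add: pixley_roy_def topology_inverse')
qed

lemma topspace_pixley_roy: "topspace (pixley_roy X) = finite_subsets X"
proof
  show "topspace (pixley_roy X) \<subseteq> finite_subsets X"
    unfolding topspace_def openin_pixley_roy
    by (auto simp: union_of_def arbitrary_def pixley_roy_base_def pixley_roy_box_def)
  show "finite_subsets X \<subseteq> topspace (pixley_roy X)"
  proof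
    fix F assume F: "F \<in> finite_subsets X"
    then have "pixley_roy_box X F (topspace X) \<in> pixley_roy_base X"
      by (auto simp: pixley_roy_base_def finite_subsets_def)
    then have "openin (pixley_roy X) (pixley_roy_box X F (topspace X))"
      by (simp add: openin_pixley_roy union_of_inc arbitrary_def)
    moreover have "F \<in> pixley_roy_box X F (topspace X)"
      using F by (auto simp: pixley_roy_box_def finite_subsets_def)
    ultimately show "F \<in> topspace (pixley_roy X)"
      using openin_subset by blast
  qed
qed

end

(* Shrink the given open sets to boxes [F_n, U_n]. The union D of the F_n is countable, so
   nowhere separability keeps every U_n - cl D nonempty, and injective discrete selectivity picks
   x_n in it. The sets G_n = F_n + {x_n} are then distinct, since x_n lies in no F_m. A point H of
   the Pixley-Roy space has the neighbourhood [H, X - ({x_n} - H)], which contains G_n only if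
   x_n is in H, hence only for finitely many n. As the Pixley-Roy space of a T_1 space is T_1,
   this local finiteness makes {G_n} closed and relatively discrete. *)

theory Submission
  imports Defs
begin

text \<open>Finite sets are closed in a T1 space, so a neighbourhood of \<open>x\<close> that meets
  \<open>A\<close> in finitely many points can be shrunk until it meets \<open>A\<close> at most in
  \<open>x\<close>. For \<open>x\<close> outside \<open>A\<close> this gives closedness, for
  \<open>x\<close> in \<open>A\<close> relative discreteness.\<close>

lemma closed_relatively_discrete_if_finite_Int:
  assumes "t1_space X" "A \<subseteq> topspace X"
    and fin: "\<And>x. x \<in> topspace X \<Longrightarrow> \<exists>U. openin X U \<and> x \<in> U \<and> finite (U \<inter> A)"
  shows "closed_relatively_discrete X A"
proof -
  have nbhd: "\<exists>U. openin X U \<and> x \<in> U \<and> U \<inter> A \<subseteq> {x}" if x: "x \<in> topspace X" for x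
  proof -
    obtain U where U: "openin X U" "x \<in> U" "finite (U \<inter> A)"
      using fin[OF x] by blast
    then have "closedin X (U \<inter> A - {x})"
      using assms(1,2) by (auto simp: t1_space_closedin_finite)
    then have "openin X (U - (U \<inter> A - {x}))"
      using U(1) by (simp add: openin_diff)
    moreover have "x \<in> U - (U \<inter> A - {x})" "(U - (U \<inter> A - {x})) \<inter> A \<subseteq> {x}"
      using U(2) by auto
    ultimately show ?thesis by blast
  qed
  have "openin X (topspace X - A)"
    proof (subst openin_subopen, intro ballI)
    fix x assume x: "x \<in> topspace X - A"
    with nbhd obtain U where "openin X U" "x \<in> U" "U \<inter> A \<subseteq> {x}"
      by blast
    moreover have "U \<subseteq> topspace X - A"
      using calculation x openin_subset by fastforce
    ultimately show "\<exists>T. openin X T \<and> x \<in> T \<and> T \<subseteq> topspace X - A"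
      by blast
  qed
  then have "closedin X A"
    using assms(2) by (simp add: closedin_def)
  moreover have "\<forall>x\<in>A. \<exists>U. openin X U \<and> U \<inter> A = {x}"
    using nbhd assms(2) by blast
  ultimately show ?thesis
    by (simp add: closed_relatively_discrete_def)
qed

text \<open>Each point of \<open>A\<close> has an open set isolating it in \<open>A\<close>.
  Subtracting the isolating sets of the points of \<open>A \<inter> F\<close> removes exactly these
  points from \<open>A\<close>. This is what later makes the set \<open>W\<close> around a finite
  \<open>H\<close> open.\<close>

lemma closed_relatively_discrete_diff_finite:
  assumes "closed_relatively_discrete X A" "finite F"
  shows "closedin X (A - F)"
proof -
  have "\<forall>x\<in>A. \<exists>U. openin X U \<and> U \<inter> A = {x}"
    using assms(1) by (simp add: closed_relatively_discrete_def)
  from bchoice[OF this] obtain U where U: "\<And>x. x \<in> A \<Longrightarrow> openin X (U x) \<and> U x \<inter> A = {x}"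
    by blast
  then have "y \<in> U x \<longleftrightarrow> y = x" if "x \<in> A" "y \<in> A" for x y
    using that by blast
  then have "A - F = A - (\<Union>x\<in>A \<inter> F. U x)"
    by auto
  moreover have "closedin X A" "openin X (\<Union>x\<in>A \<inter> F. U x)"
    using assms(1) U by (auto simp: closed_relatively_discrete_def)
  ultimately show ?thesis
    by (simp add: closedin_diff)
qed

lemma discrete_space_discretely_selective:
  assumes "discrete_space X"
  shows "discretely_selective X"
proof -
  have open_iff: "openin X S \<longleftrightarrow> S \<subseteq> topspace X" for S
    using assms unfolding discrete_space_def by (metis openin_discrete_topology)
  \<comment> \<open>Every subset qualifies, so an arbitrary choice of points will do.\<close>
  have crd: "closed_relatively_discrete X A" if "A \<subseteq> topspace X" for A
    using that by (auto simp: closed_relatively_discrete_def closedin_def open_iff)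
  show ?thesis
    unfolding discretely_selective_def
  proof (intro allI impI)
    fix U :: "nat \<Rightarrow> 'a set"
    assume U: "\<forall>n. openin X (U n) \<and> U n \<noteq> {}"
    then have "\<forall>n. \<exists>x. x \<in> U n"
      by blast
    from choice[OF this] obtain x where x: "\<forall>n. x n \<in> U n" ..
    moreover have "range x \<subseteq> topspace X"
      using x U openin_subset by blast
    ultimately show "\<exists>x. (\<forall>n. x n \<in> U n) \<and> closed_relatively_discrete X (range x)"
      using crd by blast
  qed
qed

lemma openin_pixley_roy_box:
  assumes "F \<in> finite_subsets X" "openin X U"
  shows "openin (pixley_roy X) (pixley_roy_box X F U)"
proof (cases "U = {}")
  \<comment> \<open>The base admits only boxes over nonempty sets. Over the empty set the box is
    empty, because its members are nonempty.\<close>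
  case True
  then have "pixley_roy_box X F U = {}"
    by (auto simp: pixley_roy_box_def finite_subsets_def)
  then show ?thesis by simp
next
  case False
  then have "pixley_roy_box X F U \<in> pixley_roy_base X"
    using assms by (auto simp: pixley_roy_base_def)
  then show ?thesis
    by (simp add: openin_pixley_roy union_of_inc arbitrary_def)
qed

lemma openin_pixley_roy_contains_box:
  assumes "openin (pixley_roy X) W" "G \<in> W"
  shows "\<exists>F U. F \<in> finite_subsets X \<and> openin X U \<and>
           G \<in> pixley_roy_box X F U \<and> pixley_roy_box X F U \<subseteq> W"
proof -
  obtain \<B> where "\<B> \<subseteq> pixley_roy_base X" "\<Union>\<B> = W"
    using assms(1) unfolding openin_pixley_roy union_of_def arbitrary_def by blast
  moreover then obtain B where "B \<in> \<B>" "G \<in> B"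
    using assms(2) by blast
  ultimately have "B \<in> pixley_roy_base X" "B \<subseteq> W" "G \<in> B"
    by blast+
  then show ?thesis
    unfolding pixley_roy_base_def by blast
qed

lemma discrete_space_pixley_roy:
  assumes "discrete_space X"
  shows "discrete_space (pixley_roy X)"
proof -
  have "openin (pixley_roy X) {F}" if F: "F \<in> finite_subsets X" for F
  proof -
    \<comment> \<open>A finite set \<open>F\<close> is now itself open, so it can serve as its own
      upper bound, and the box \<open>[F, F]\<close> isolates it.\<close>
    have "openin X F"
      using F assms unfolding discrete_space_def finite_subsets_def
      by (metis (no_types, lifting) mem_Collect_eq openin_discrete_topology)
    moreover have "pixley_roy_box X F F = {F}"
      using F by (auto simp: pixley_roy_box_def)
    ultimately show ?thesis
      using openin_pixley_roy_box[OF F] by metis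
  qed
  then show ?thesis
    unfolding discrete_space_def
    by (metis discrete_topology_unique topspace_pixley_roy)
qed

lemma t1_space_pixley_roy:
  assumes "t1_space X"
  shows "t1_space (pixley_roy X)"
  unfolding t1_space_def
proof (intro ballI impI)
  fix F G assume "F \<in> topspace (pixley_roy X)" "G \<in> topspace (pixley_roy X)" and "F \<noteq> G"
  then have F: "F \<in> finite_subsets X" and G: "G \<in> finite_subsets X"
    by (simp_all add: topspace_pixley_roy)
  \<comment> \<open>This \<open>U\<close> separates in both cases: if \<open>G\<close> has a point
    outside \<open>F\<close>, then \<open>G\<close> is not contained in \<open>U\<close>; otherwise
    \<open>G\<close> is a proper subset of \<open>F\<close> and fails the lower bound of the
    box.\<close>
  define U where "U = topspace X - (G - F)"
  have "openin X U"
    unfolding U_def using G assms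
    by (intro openin_diff) (auto simp: t1_space_closedin_finite finite_subsets_def)
  moreover have "F \<in> pixley_roy_box X F U" "G \<notin> pixley_roy_box X F U"
    using F G \<open>F \<noteq> G\<close> by (auto simp: pixley_roy_box_def finite_subsets_def U_def)
  ultimately show "\<exists>W. openin (pixley_roy X) W \<and> F \<in> W \<and> G \<notin> W"
    using openin_pixley_roy_box[OF F] by blast
qed

text \<open>If the closure of \<open>D\<close> covered \<open>U\<close>, then, \<open>U\<close>
  being open, the countable set \<open>U \<inter> D\<close> would be dense in
  \<open>U\<close>.\<close>

lemma nowhere_separable_diff_closure_of_countable:
  assumes "nowhere_separable X" "openin X U" "U \<noteq> {}" "countable D"
  shows "U - X closure_of D \<noteq> {}"
proof
  assume "U - X closure_of D = {}"
  then have "U \<subseteq> X closure_of (U \<inter> D)"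
    using openin_Int_closure_of_subset[OF assms(2), of D] by blast
  then have "subtopology X U closure_of (U \<inter> D) = topspace (subtopology X U)"
    using openin_subset[OF assms(2)] by (auto simp: closure_of_subtopology Int_absorb1)
  then have "separable_space (subtopology X U)"
    using assms(2,4) openin_subset[OF assms(2)]
    unfolding separable_space_def by (intro exI[of _ "U \<inter> D"]) auto
  then show False
    using assms unfolding nowhere_separable_def by blast
qed

lemma closed_relatively_discrete_pixley_roy:
  assumes "t1_space X" "inj x" "closed_relatively_discrete X (range x)"
    and G: "\<And>n. G n \<in> finite_subsets X" "\<And>n. x n \<in> G n"
  shows "closed_relatively_discrete (pixley_roy X) (range G)"
proof (rule closed_relatively_discrete_if_finite_Int)
  show "t1_space (pixley_roy X)"
    using assms(1) by (rule t1_space_pixley_roy)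
  show "range G \<subseteq> topspace (pixley_roy X)"
    using G(1) by (auto simp: topspace_pixley_roy)
  fix H assume "H \<in> topspace (pixley_roy X)"
  then have H: "H \<in> finite_subsets X" "finite H" "H \<subseteq> topspace X"
    by (auto simp: topspace_pixley_roy finite_subsets_def)
  \<comment> \<open>All selected points are removed except those in \<open>H\<close>, so that
    \<open>H\<close> still lies in \<open>W\<close>.\<close>
  define W where "W = topspace X - (range x - H)"
  have "openin X W"
    unfolding W_def using assms(3) H(2)
    by (intro openin_diff closed_relatively_discrete_diff_finite) auto
  moreover have "H \<in> pixley_roy_box X H W"
    using H by (auto simp: pixley_roy_box_def W_def)
  moreover have "finite (pixley_roy_box X H W \<inter> range G)"
  proof (rule finite_subset)
    \<comment> \<open>If \<open>G n\<close> is contained in \<open>W\<close>, so is its element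
      \<open>x n\<close>, and the only values of \<open>x\<close> in \<open>W\<close> are those in
      \<open>H\<close>. Injectivity of \<open>x\<close> then leaves finitely many such
      \<open>n\<close>.\<close>
    show "pixley_roy_box X H W \<inter> range G \<subseteq> G ` (x -` H)"
      using G(2) by (fastforce simp: pixley_roy_box_def W_def)
    show "finite (G ` (x -` H))"
      using H(2) assms(2) by (simp add: finite_vimageI)
  qed
  ultimately show "\<exists>U. openin (pixley_roy X) U \<and> H \<in> U \<and> finite (U \<inter> range G)"
    using openin_pixley_roy_box[OF H(1)] by blast
qed

lemma injectively_discretely_selective_pixley_roy:
  assumes "t1_space X" "injectively_discretely_selective X" "nowhere_separable X"
  shows "injectively_discretely_selective (pixley_roy X)"
  unfolding injectively_discretely_selective_def
proof (intro allI impI)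
  fix W :: "nat \<Rightarrow> 'a set set"
  assume W: "\<forall>n. openin (pixley_roy X) (W n) \<and> W n \<noteq> {}"
  \<comment> \<open>The inclusion of \<open>F\<close> in \<open>U\<close> records that the box is
    nonempty; it comes from any \<open>G\<close> in the box, which lies between them.\<close>
  have "\<exists>F U. F \<in> finite_subsets X \<and> openin X U \<and> F \<subseteq> U \<and> pixley_roy_box X F U \<subseteq> W n" for n
  proof -
    obtain G where "G \<in> W n"
      using W by blast
    then obtain F U where "F \<in> finite_subsets X" "openin X U"
      "G \<in> pixley_roy_box X F U" "pixley_roy_box X F U \<subseteq> W n"
      using openin_pixley_roy_contains_box W by blast
    then show ?thesis
      unfolding pixley_roy_box_def by blast
  qed
  then obtain F U where FU: "\<And>n. F n \<in> finite_subsets X" "\<And>n. openin X (U n)"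
    "\<And>n. F n \<subseteq> U n" "\<And>n. pixley_roy_box X (F n) (U n) \<subseteq> W n"
    by metis
  define D where "D = (\<Union>n. F n)"
  have F: "finite (F n)" "F n \<noteq> {}" "F n \<subseteq> topspace X" for n
    using FU(1)[of n] by (auto simp: finite_subsets_def)
  have "countable D"
    using F(1) by (simp add: D_def countable_finite)
  moreover have "U n \<noteq> {}" for n
    using F(2)[of n] FU(3)[of n] by blast
  \<comment> \<open>Subtracting the closure rather than \<open>D\<close> itself keeps the sets open,
    so that the selection hypothesis applies to them.\<close>
  ultimately have "\<forall>n. openin X (U n - X closure_of D) \<and> U n - X closure_of D \<noteq> {}"
    using nowhere_separable_diff_closure_of_countable[OF assms(3) FU(2)]
    by (simp add: FU(2) openin_diff)
  then obtain x where x: "\<And>n. x n \<in> U n - X closure_of D"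
    "closed_relatively_discrete X (range x)" "inj x"
    using assms(2)[unfolded injectively_discretely_selective_def, THEN spec,
        of "\<lambda>n. U n - X closure_of D"] by auto
  have "D \<subseteq> X closure_of D"
    using F(3) by (intro closure_of_subset) (auto simp: D_def)
  then have notin: "x n \<notin> F m" for m n
    using x(1)[of n] by (auto simp: D_def)
  define G where "G n = insert (x n) (F n)" for n
  \<comment> \<open>Adding a point of \<open>U n\<close> to \<open>F n\<close> respects both bounds
    of the box, so \<open>G n\<close> stays inside \<open>W n\<close>.\<close>
  have box: "G n \<in> pixley_roy_box X (F n) (U n)" for n
    using F[of n] FU(3)[of n] x(1)[of n] openin_subset[OF FU(2)[of n]]
    by (auto simp: G_def pixley_roy_box_def finite_subsets_def)
  have "inj G"
  proof (rule injI)
    fix m n assume "G m = G n"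
    then have "x m \<in> insert (x n) (F n)"
      by (auto simp: G_def)
    \<comment> \<open>Since \<open>x m\<close> avoids \<open>F n\<close>, it must equal
      \<open>x n\<close>.\<close>
    then show "m = n"
      using notin x(3) by (auto dest: injD)
  qed
  moreover have "closed_relatively_discrete (pixley_roy X) (range G)"
    using box by (intro closed_relatively_discrete_pixley_roy[OF assms(1) x(3,2)])
      (auto simp: pixley_roy_box_def G_def)
  moreover have "\<forall>n. G n \<in> W n"
    using box FU(4) by blast
  ultimately show "\<exists>G. (\<forall>n. G n \<in> W n) \<and> closed_relatively_discrete (pixley_roy X) (range G) \<and> inj G"
    by blast
qed

lemma injectively_discretely_selective_imp:
  assumes "injectively_discretely_selective X"
  shows "discretely_selective X"
  unfolding discretely_selective_def
proof (intro allI impI)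
  fix U :: "nat \<Rightarrow> 'a set"
  assume "\<forall>n. openin X (U n) \<and> U n \<noteq> {}"
  with assms[unfolded injectively_discretely_selective_def, THEN spec, of U]
  show "\<exists>x. (\<forall>n. x n \<in> U n) \<and> closed_relatively_discrete X (range x)"
    by auto
qed

theorem theorem3p20:
  fixes X :: "'a topology"
  assumes "topspace X \<noteq> {}"
  shows "(discrete_space X \<longrightarrow>
            discrete_space (pixley_roy X) \<and>
            discretely_selective X \<and> discretely_selective (pixley_roy X)) \<and>
         (t1_space X \<and> injectively_discretely_selective X \<and> nowhere_separable X \<longrightarrow>
            injectively_discretely_selective (pixley_roy X) \<and>
            discretely_selective (pixley_roy X))"
  using discrete_space_pixley_roy discrete_space_discretely_selective
    injectively_discretely_selective_pixley_roy injectively_discretely_selective_imp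
  by metis

end
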